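(* Let $F$ be an ordered graph such that $\mathrm{core}(F)$ is not a forest. Then there is a constant $c>0$ (depending on $F$) such that for every sufficiently small $\varepsilon>0$ and every $n \geq n_0(\varepsilon)$ there exists an ordered graph $G$ on $n$ vertices which contains at most $\varepsilon^{c\log(1/\varepsilon)}n^{v(F)}$ copies of $F$, but from which one has to remove at least $\varepsilon n^{2}$ edges to destroy all copies of $F$.
   Context: An ordered graph is a graph with a linear order $\leq$ on its vertex set. A copy of an ordered graph $H$ in an ordered graph $G$ is given by an order-preserving injection $V(H)\to V(G)$ mapping edges to edges (not necessarily induced). A homomorphism from an ordered graph $G_1$ to an ordered graph $G_2$ is a map $\varphi:V(G_1)\to V(G_2)$ such that $\{\varphi(x),\varphi(y)\}\in E(G_2)$ for every $\{x,y\}\in E(G_1)$ and $\varphi(x)\leq\varphi(y)$ whenever $x\leq y$. The core $\mathrm{core}(G)$ of an ordered graph $G$ is a subgraph of $G$ with the smallest number of vertices to which there is a homomorphism from $G$ (it is unique up to isomorphism). A forest is a graph with no cycle. *)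

theory Defs
  imports Complex_Main "HOL-Library.FuncSet"
begin

text \<open>
  The linear order on the vertex set of an ordered graph is the restriction of the order of the
  vertex type. Graphs are finite and simple; edges are unordered pairs.
\<close>

record 'v ograph =
  verts :: "'v set"
  edges :: "'v set set"

definition ordered_graph :: "'v::linorder ograph \<Rightarrow> bool" where
  "ordered_graph G \<longleftrightarrow> finite (verts G) \<and> edges G \<subseteq> {e. e \<subseteq> verts G \<and> card e = 2}"

definition ordered_hom :: "('v::linorder \<Rightarrow> 'w::linorder) \<Rightarrow> 'v ograph \<Rightarrow> 'w ograph \<Rightarrow> bool" where
  "ordered_hom \<phi> G1 G2 \<longleftrightarrow>
     \<phi> \<in> verts G1 \<rightarrow> verts G2 \<and>
     (\<forall>x y. {x, y} \<in> edges G1 \<longrightarrow> {\<phi> x, \<phi> y} \<in> edges G2) \<and>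
     mono_on (verts G1) \<phi>"

text \<open>
  Copies are counted as maps on \<^term>\<open>verts H\<close>; extensionality fixes their values elsewhere, so
  that each of them is counted once.
\<close>

definition copies :: "'v::linorder ograph \<Rightarrow> 'w::linorder ograph \<Rightarrow> ('v \<Rightarrow> 'w) set" where
  "copies H G = {\<phi> \<in> extensional (verts H). ordered_hom \<phi> H G \<and> inj_on \<phi> (verts H)}"

definition subgraph :: "'v::linorder ograph \<Rightarrow> 'v ograph \<Rightarrow> bool" where
  "subgraph H G \<longleftrightarrow> ordered_graph H \<and> verts H \<subseteq> verts G \<and> edges H \<subseteq> edges G"

text \<open>A relation rather than a function, because the core is unique only up to isomorphism.\<close>

definition is_core :: "'v::linorder ograph \<Rightarrow> 'v ograph \<Rightarrow> bool" where
  "is_core C G \<longleftrightarrow>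
     subgraph C G \<and> (\<exists>\<phi>. ordered_hom \<phi> G C) \<and>
     (\<forall>D. subgraph D G \<and> (\<exists>\<phi>. ordered_hom \<phi> G D) \<longrightarrow> card (verts C) \<le> card (verts D))"

definition is_cycle :: "'v ograph \<Rightarrow> 'v list \<Rightarrow> bool" where
  "is_cycle G xs \<longleftrightarrow>
     3 \<le> length xs \<and> distinct xs \<and>
     (\<forall>i < length xs. {xs ! i, xs ! (Suc i mod length xs)} \<in> edges G)"

definition forest :: "'v ograph \<Rightarrow> bool" where
  "forest G \<longleftrightarrow> (\<nexists>xs. is_cycle G xs)"

definition remove_edges :: "'v ograph \<Rightarrow> 'v set set \<Rightarrow> 'v ograph" where
  "remove_edges G S = G\<lparr>edges := edges G - S\<rparr>"

end

theory Submission
  imports Defs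
begin

text \<open>
  Blow up \<open>F\<close> over the grid \<open>{0..<hD}\<^sup>r\<close>: each vertex \<open>f\<close> becomes an interval of vertices that carry
  grid points, and for every base point \<open>z\<close> and every direction \<open>y\<close> in a Behrend sphere \<open>X\<close> a copy of
  \<open>F\<close> is planted that puts \<open>f\<close> at the point \<open>z + a(\<phi> f) y\<close>, where \<open>\<phi> : F \<rightarrow> core(F)\<close> and \<open>a\<close> is an
  injective labelling of the core by integers that counts \<open>0, 1, 2, \<dots>\<close> along a cycle. An edge
  determines \<open>z\<close> and \<open>y\<close>, so these copies are destroyed only by removing many edges. Conversely, the
  core of an ordered graph admits no endomorphism but the identity, so every copy of \<open>F\<close> contains a
  closed walk over the cycle; its steps satisfy a convex equation in \<open>X\<close>, which forces them to be equal.
  Hence two vertices of the copy determine the grid point of a third one, and copies are rare. With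
  \<open>D = h\<^sup>r\<close> the density of planted edges is \<open>h\<close> to the power \<open>-O(r)\<close>, and that of copies is at most
  \<open>h\<close> to the power \<open>-r\<^sup>2\<close>.
\<close>

section \<open>Grid boxes and large sets without convex relations\<close>

definition box :: "nat \<Rightarrow> nat \<Rightarrow> (nat \<Rightarrow> nat) set" where
  "box r D = {..<r} \<rightarrow>\<^sub>E {..<D}"

lemma finite_box [simp]: "finite (box r D)"
  by (auto simp: box_def intro: finite_PiE)

lemma card_box [simp]: "card (box r D) = D ^ r"
  by (simp add: box_def card_PiE)

lemma box_eqI:
  assumes "u \<in> box r D" "v \<in> box r D'" "\<And>t. t < r \<Longrightarrow> u t = v t"
  shows "u = v"
  using assms unfolding box_def by (intro PiE_ext[of u _ _ v]) (auto simp: PiE_def)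

text \<open>Multiplying the mean by \<open>q\<close> keeps the equation in the natural numbers.
  Since \<open>q\<close> is arbitrary and the \<open>y i\<close> may repeat, cycles of every length
  are covered at once.\<close>

definition convex_free :: "nat \<Rightarrow> (nat \<Rightarrow> nat) set \<Rightarrow> bool" where
  "convex_free r X \<longleftrightarrow> (\<forall>q y y0. (\<forall>i<q. y i \<in> X) \<longrightarrow> y0 \<in> X \<longrightarrow>
     (\<forall>t<r. (\<Sum>i<q. y i t) = q * y0 t) \<longrightarrow> (\<forall>i<q. y i = y0))"

text \<open>The identity \<open>\<Sum>\<^sub>i \<bar>y\<^sub>i - y\<^sub>0\<bar>\<^sup>2 = \<Sum>\<^sub>i \<bar>y\<^sub>i\<bar>\<^sup>2 - q \<bar>y\<^sub>0\<bar>\<^sup>2\<close> holds whenever \<open>y\<^sub>0\<close> is the mean of the \<open>y\<^sub>i\<close>.\<close>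

lemma sphere_convex_free: "convex_free r {u \<in> box r D. (\<Sum>t<r. (u t)\<^sup>2) = R}"
  unfolding convex_free_def
proof (intro allI impI)
  fix q y y0 i
  let ?X = "{u \<in> box r D. (\<Sum>t<r. (u t)\<^sup>2) = R}"
  assume y: "\<forall>i<q. y i \<in> ?X" and y0: "y0 \<in> ?X"
    and mean: "\<forall>t<r. (\<Sum>i<q. y i t) = q * y0 t" and i: "i < q"
  define z where "z i t = int (y i t)" for i t
  define z0 where "z0 t = int (y0 t)" for t
  have n: "(\<Sum>t<r. (z i t)\<^sup>2) = int R" if "i < q" for i
  proof -
    have "(\<Sum>t<r. (y i t)\<^sup>2) = R" using y that by auto
    then show ?thesis unfolding z_def by (metis (mono_tags, lifting) of_nat_power of_nat_sum sum.cong)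
  qed
  have n0: "(\<Sum>t<r. (z0 t)\<^sup>2) = int R"
  proof -
    have "(\<Sum>t<r. (y0 t)\<^sup>2) = R" using y0 by auto
    then show ?thesis unfolding z0_def by (metis (mono_tags, lifting) of_nat_power of_nat_sum sum.cong)
  qed
  have m: "(\<Sum>i<q. z i t) = int q * z0 t" if "t < r" for t
    using mean that unfolding z_def z0_def by (metis of_nat_mult of_nat_sum)
  have cross: "(\<Sum>i<q. \<Sum>t<r. z i t * z0 t) = int q * int R"
  proof -
    have "(\<Sum>i<q. \<Sum>t<r. z i t * z0 t) = (\<Sum>t<r. (\<Sum>i<q. z i t) * z0 t)"
      by (subst sum.swap) (simp add: sum_distrib_right)
    also have "\<dots> = (\<Sum>t<r. int q * (z0 t)\<^sup>2)"
      by (intro sum.cong) (auto simp: m power2_eq_square)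
    finally show ?thesis by (simp add: n0 flip: sum_distrib_left)
  qed
  have "(\<Sum>i<q. \<Sum>t<r. (z i t - z0 t)\<^sup>2)
      = (\<Sum>i<q. (\<Sum>t<r. (z i t)\<^sup>2) + (\<Sum>t<r. (z0 t)\<^sup>2) - 2 * (\<Sum>t<r. z i t * z0 t))"
    by (intro sum.cong)
       (auto simp: power2_diff sum.distrib sum_subtractf sum_distrib_left mult.assoc)
  also have "\<dots> = (\<Sum>i<q. 2 * int R - 2 * (\<Sum>t<r. z i t * z0 t))"
    by (intro sum.cong) (auto simp: n n0)
  also have "\<dots> = 0"
    by (simp add: sum_subtractf cross flip: sum_distrib_left)
  finally have "\<forall>i<q. (\<Sum>t<r. (z i t - z0 t)\<^sup>2) = 0"
    by (subst (asm) sum_nonneg_eq_0_iff) (auto intro: sum_nonneg)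
  with i have "(\<Sum>t<r. (z i t - z0 t)\<^sup>2) = 0" by blast
  then have "\<forall>t<r. z i t = z0 t"
    by (subst (asm) sum_nonneg_eq_0_iff) auto
  then show "y i = y0"
    using y y0 i by (intro box_eqI[of _ r D _ D]) (auto simp: z_def z0_def)
qed

text \<open>Pigeonhole: the squared norm takes fewer than \<open>r * D\<^sup>2\<close> values on the
  \<open>D ^ r\<close> points, so some sphere holds at least an average share.\<close>

lemma large_convex_free_set:
  assumes "r > 0" "D > 0"
  obtains X where "X \<subseteq> box r D" "convex_free r X" "D ^ r \<le> r * D\<^sup>2 * card X"
proof -
  define f where "f u = (\<Sum>t<r. (u t)\<^sup>2)" for u :: "nat \<Rightarrow> nat"
  have lt: "f u < r * D\<^sup>2" if "u \<in> box r D" for u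
  proof -
    have "f u < (\<Sum>t<r. D\<^sup>2)"
      unfolding f_def
    proof (rule sum_strict_mono)
      fix t assume "t \<in> {..<r}"
      then have "u t < D" using that by (auto simp: box_def)
      then show "(u t)\<^sup>2 < D\<^sup>2" by (rule power_strict_mono) auto
    qed (use assms in auto)
    then show ?thesis by simp
  qed
  have "\<exists>R. D ^ r \<le> r * D\<^sup>2 * card {u \<in> box r D. f u = R}"
  proof (rule ccontr)
    assume "\<nexists>R. D ^ r \<le> r * D\<^sup>2 * card {u \<in> box r D. f u = R}"
    then have *: "r * D\<^sup>2 * card {u \<in> box r D. f u = R} < D ^ r" for R
      by (meson not_le)
    have "D ^ r = (\<Sum>R<r * D\<^sup>2. card {u \<in> box r D. f u = R})"
    proof -
      have "(\<Sum>R<r * D\<^sup>2. \<Sum>u | u \<in> box r D \<and> f u = R. 1::nat) = (\<Sum>u\<in>box r D. 1)"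
        by (rule sum.group) (auto simp: lt)
      then show ?thesis by simp
    qed
    then have "r * D\<^sup>2 * D ^ r = (\<Sum>R<r * D\<^sup>2. r * D\<^sup>2 * card {u \<in> box r D. f u = R})"
      by (simp add: sum_distrib_left)
    also have "\<dots> < (\<Sum>R<r * D\<^sup>2. D ^ r)"
      using assms by (intro sum_strict_mono *) (auto simp: lessThan_empty_iff)
    finally show False by simp
  qed
  then obtain R where R: "D ^ r \<le> r * D\<^sup>2 * card {u \<in> box r D. f u = R}" by blast
  show thesis
    by (rule that[of "{u \<in> box r D. f u = R}"])
       (use R sphere_convex_free[of r D R] in \<open>auto simp: f_def\<close>)
qed

text \<open>
  A cyclic chain in which the \<open>i\<close>-th step adds \<open>y i\<close> and the closing step subtracts \<open>k - 1\<close> times a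
  single vector is a convex equation, so all steps coincide.
\<close>

lemma cycle_rigid:
  fixes p :: "nat \<Rightarrow> nat \<Rightarrow> nat"
  assumes X: "convex_free r X" and k: "3 \<le> k"
    and step: "\<And>i. Suc i < k \<Longrightarrow> \<exists>y\<in>X. \<forall>t<r. p (Suc i) t = p i t + y t"
    and close: "\<exists>y\<in>X. \<forall>t<r. p (k - 1) t = p 0 t + (k - 1) * y t"
    and t: "t < r"
  shows "p 2 t + p 0 t = 2 * p 1 t"
proof -
  define y where "y i = (SOME y. y \<in> X \<and> (\<forall>t<r. p (Suc i) t = p i t + y t))" for i
  have "y i \<in> X \<and> (\<forall>t<r. p (Suc i) t = p i t + y i t)" if "Suc i < k" for i
  proof -
    have "\<exists>y. y \<in> X \<and> (\<forall>t<r. p (Suc i) t = p i t + y t)" using step[OF that] by blast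
    then show ?thesis unfolding y_def by (rule someI_ex)
  qed
  then have y: "\<And>i. Suc i < k \<Longrightarrow> y i \<in> X"
    "\<And>i t. Suc i < k \<Longrightarrow> t < r \<Longrightarrow> p (Suc i) t = p i t + y i t"
    by blast+
  obtain y0 where y0: "y0 \<in> X" "\<And>t. t < r \<Longrightarrow> p (k - 1) t = p 0 t + (k - 1) * y0 t"
    using close by blast
  have sum: "p i t = p 0 t + (\<Sum>j<i. y j t)" if "i < k" "t < r" for i t
    using that by (induction i) (auto simp: y)
  have "(\<Sum>i<k - 1. y i t) = (k - 1) * y0 t" if "t < r" for t
    using sum[of "k - 1" t] y0(2)[OF that] k that by simp
  moreover have "y i \<in> X" if "i < k - 1" for i using that by (intro y(1)) linarith
  ultimately have eq: "y i = y0" if "i < k - 1" for i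
    using X[unfolded convex_free_def, rule_format, of "k - 1" y y0 i] y0(1) that by blast
  \<comment> \<open>As \<open>3 \<le> k\<close>, both 0 and 1 are indices of steps; equal steps put
    the first three points in arithmetic progression.\<close>
  have "y 0 = y0" "y 1 = y0" using k by (auto intro!: eq)
  then show ?thesis using y(2)[of 0 t] y(2)[of 1 t] k t by (simp add: numeral_2_eq_2)
qed

section \<open>Ordered homomorphisms and the rigidity of the core\<close>

lemma ordered_hom_comp:
  assumes "ordered_hom f G1 G2" "ordered_hom g G2 G3"
  shows "ordered_hom (g \<circ> f) G1 G3"
  using assms unfolding ordered_hom_def monotone_on_def by (auto simp: Pi_iff)

lemma ordered_hom_subgraph:
  assumes "ordered_hom f G G'" "subgraph H G"
  shows "ordered_hom f H G'"
  using assms monotone_on_subset unfolding ordered_hom_def subgraph_def by blast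

text \<open>If \<open>f\<close> moved \<open>x\<close> down, it would inject the points below
  \<open>x\<close> into the strictly smaller set of points below \<open>f x\<close>; if it moved
  \<open>x\<close> up, the same happens with the points above.\<close>

lemma mono_bij_betw_id:
  fixes f :: "'a::linorder \<Rightarrow> 'a"
  assumes "finite A" "mono_on A f" "f ` A = A" "x \<in> A"
  shows "f x = x"
proof -
  have inj: "inj_on f A" using assms by (simp add: eq_card_imp_inj_on)
  have lt: "f a < f b" if "a \<in> A" "b \<in> A" "a < b" for a b
    using that assms(2) inj by (metis inj_on_def less_imp_le monotone_on_def order_le_less less_irrefl)
  show ?thesis
  proof (cases "f x" x rule: linorder_cases)
    case equal then show ?thesis .
  next
    case less
    have "f ` {a \<in> A. a < x} \<subseteq> {a \<in> A. a < f x}" using lt assms(3,4) by auto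
    then have "card (f ` {a \<in> A. a < x}) \<le> card {a \<in> A. a < f x}"
      using assms(1) by (intro card_mono) auto
    then have "card {a \<in> A. a < x} \<le> card {a \<in> A. a < f x}"
      using inj by (subst (asm) card_image) (auto intro: inj_on_subset)
    moreover have "{a \<in> A. a < f x} \<subset> {a \<in> A. a < x}"
      using less assms(3,4) by auto
    ultimately show ?thesis using assms(1) psubset_card_mono[of "{a \<in> A. a < x}" "{a \<in> A. a < f x}"] by auto
  next
    case greater
    have "f ` {a \<in> A. x < a} \<subseteq> {a \<in> A. f x < a}" using lt assms(3,4) by auto
    then have "card (f ` {a \<in> A. x < a}) \<le> card {a \<in> A. f x < a}"
      using assms(1) by (intro card_mono) auto
    then have "card {a \<in> A. x < a} \<le> card {a \<in> A. f x < a}"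
      using inj by (subst (asm) card_image) (auto intro: inj_on_subset)
    moreover have "{a \<in> A. f x < a} \<subset> {a \<in> A. x < a}"
      using greater assms(3,4) by auto
    ultimately show ?thesis using assms(1) psubset_card_mono[of "{a \<in> A. x < a}" "{a \<in> A. f x < a}"] by auto
  qed
qed

text \<open>
  The order makes the core rigid: an endomorphism of it is bijective by minimality, and a monotone
  bijection of a finite chain is the identity.
\<close>

lemma core_rigid:
  assumes "is_core C F" and \<phi>: "ordered_hom \<phi> F C" and \<psi>: "ordered_hom \<psi> F F" and v: "v \<in> verts C"
  shows "\<phi> (\<psi> v) = v"
proof -
  define \<theta> where "\<theta> = \<phi> \<circ> \<psi>"
  have sub: "subgraph C F" and min: "\<And>D \<phi>. subgraph D F \<Longrightarrow> ordered_hom \<phi> F D \<Longrightarrow> card (verts C) \<le> card (verts D)"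
    using assms(1) unfolding is_core_def by auto
  have \<theta>: "ordered_hom \<theta> C C"
    unfolding \<theta>_def using ordered_hom_comp[OF \<psi> \<phi>] sub by (rule ordered_hom_subgraph)
  have fin: "finite (verts C)" using sub by (auto simp: subgraph_def ordered_graph_def)
  have im: "\<theta> ` verts C \<subseteq> verts C" using \<theta> by (auto simp: ordered_hom_def)
  \<comment> \<open>The subgraph that \<open>C\<close> induces on the image of
    \<open>\<theta>\<close>. As \<open>\<theta> \<circ> \<phi>\<close> maps \<open>F\<close> to it,
    it competes with \<open>C\<close> for the smallest number of vertices.\<close>
  define D where "D = \<lparr>verts = \<theta> ` verts C, edges = {e \<in> edges C. e \<subseteq> \<theta> ` verts C}\<rparr>"
  have D: "subgraph D F"
    using sub im fin by (auto simp: D_def subgraph_def ordered_graph_def)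
  have in_verts: "x \<in> verts C" "y \<in> verts C" if "{x, y} \<in> edges C" for x y
    using sub that by (auto simp: subgraph_def ordered_graph_def)
  have "ordered_hom \<theta> C D"
    using \<theta> in_verts by (auto simp: ordered_hom_def D_def)
  then have "ordered_hom (\<theta> \<circ> \<phi>) F D" by (rule ordered_hom_comp[OF \<phi>])
  from min[OF D this] have "card (verts C) \<le> card (\<theta> ` verts C)" by (simp add: D_def)
  then have "\<theta> ` verts C = verts C" using im fin by (simp add: card_seteq)
  then have "\<theta> v = v"
    using mono_bij_betw_id[OF fin _ _ v] \<theta> by (auto simp: ordered_hom_def)
  then show ?thesis by (simp add: \<theta>_def)
qed

section \<open>Labels of the core and counting lemmas\<close>

lemma cycle_labelling:
  assumes "finite V" "distinct xs" "set xs \<subseteq> V"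
  obtains a where "inj_on a V" "\<And>v. v \<in> V \<Longrightarrow> a v < card V" "\<And>i. i < length xs \<Longrightarrow> a (xs ! i) = i"
proof -
  obtain zs where zs: "set zs = V - set xs" "distinct zs"
    using finite_distinct_list[of "V - set xs"] assms(1) by auto
  \<comment> \<open>With the cycle listed first, the position of a vertex in \<open>ys\<close>
    serves as its label.\<close>
  define ys where "ys = xs @ zs"
  have ys: "distinct ys" "set ys = V" using zs assms by (auto simp: ys_def)
  then have len: "length ys = card V" by (metis distinct_card)
  have bij: "bij_betw ((!) ys) {..<card V} V" using bij_betw_nth[OF ys(1)] ys(2) len by auto
  define a where "a = inv_into {..<card V} ((!) ys)"
  have ba: "bij_betw a V {..<card V}" unfolding a_def by (rule bij_betw_inv_into[OF bij])
  show thesis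
  proof (rule that)
    show "inj_on a V" using ba by (rule bij_betw_imp_inj_on)
    show "a v < card V" if "v \<in> V" for v using bij_betwE[OF ba] that by auto
    show "a (xs ! i) = i" if "i < length xs" for i
    proof -
      have "i < card V" using that len by (simp add: ys_def)
      moreover have "xs ! i = ys ! i" using that by (simp add: ys_def nth_append)
      ultimately show ?thesis unfolding a_def using bij by (simp add: bij_betw_imp_inj_on inv_into_f_f)
    qed
  qed
qed

text \<open>A member is determined by its quotient \<open>w div N\<close>. Such classes will be the
  sets of vertices over one grid point.\<close>

lemma card_mod_class: "card {w. w < n \<and> w mod N = c} \<le> n div N + 1" for n :: nat
proof -
  have "inj_on (\<lambda>w. w div N) {w. w < n \<and> w mod N = c}"
    by (intro inj_onI) (metis (mono_tags, lifting) div_mult_mod_eq mem_Collect_eq)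
  moreover have "(\<lambda>w. w div N) ` {w. w < n \<and> w mod N = c} \<subseteq> {..n div N}"
    by (auto intro: div_le_mono)
  ultimately show ?thesis
    using card_inj_on_le[of _ _ "{..n div N}"] by fastforce
qed

text \<open>Meant for copies of \<open>F\<close>: \<open>T\<close> collects the vertices still
  possible at one place once the rest of the copy is known.\<close>

lemma card_PiE_determined:
  assumes "finite A" "finite B" "x \<in> A" "\<And>g. finite (T g)" "\<And>g. card (T g) \<le> M"
  shows "card {\<kappa> \<in> A \<rightarrow>\<^sub>E B. \<kappa> x \<in> T (restrict \<kappa> (A - {x}))} \<le> card B ^ (card A - 1) * M"
proof -
  let ?K = "{\<kappa> \<in> A \<rightarrow>\<^sub>E B. \<kappa> x \<in> T (restrict \<kappa> (A - {x}))}"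
  let ?P = "(A - {x}) \<rightarrow>\<^sub>E B"
  have finP: "finite ?P" using assms by (intro finite_PiE) auto
  have "inj_on (\<lambda>\<kappa>. (restrict \<kappa> (A - {x}), \<kappa> x)) ?K"
  proof (rule inj_onI, clarify)
    fix \<kappa> \<kappa>' assume k: "\<kappa> \<in> A \<rightarrow>\<^sub>E B" "\<kappa>' \<in> A \<rightarrow>\<^sub>E B"
      and eq: "restrict \<kappa> (A - {x}) = restrict \<kappa>' (A - {x})" "\<kappa> x = \<kappa>' x"
    have "\<kappa> y = \<kappa>' y" if "y \<in> A" for y
      using fun_cong[OF eq(1), of y] eq(2) that by (cases "y = x") auto
    then show "\<kappa> = \<kappa>'" using k by (intro PiE_ext) auto
  qed
  moreover have "(\<lambda>\<kappa>. (restrict \<kappa> (A - {x}), \<kappa> x)) ` ?K \<subseteq> Sigma ?P T"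
    by (auto simp: PiE_def Pi_iff)
  moreover have "finite (Sigma ?P T)" using finP assms by auto
  ultimately have "card ?K \<le> card (Sigma ?P T)" by (rule card_inj_on_le)
  also have "\<dots> = (\<Sum>g\<in>?P. card (T g))" using finP assms by (simp add: card_SigmaI)
  also have "\<dots> \<le> (\<Sum>g\<in>?P. M)" using assms by (intro sum_mono) auto
  also have "\<dots> = card B ^ (card A - 1) * M" using assms by (simp add: card_PiE)
  finally show ?thesis .
qed

text \<open>Meant for the planted copies through a given edge, whose ends fix the block choice
  \<open>j\<close> at two vertices of \<open>F\<close>.\<close>

lemma card_PiE_two_fixed:
  assumes "finite A" "finite B" "f \<in> A" "g \<in> A" "f \<noteq> g"
  shows "card {j \<in> A \<rightarrow>\<^sub>E B. j f = c \<and> j g = d} \<le> card B ^ (card A - 2)"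
proof -
  let ?P = "A - {f, g} \<rightarrow>\<^sub>E B"
  have finP: "finite ?P" using assms by (intro finite_PiE) auto
  have "inj_on (\<lambda>j. restrict j (A - {f, g})) {j \<in> A \<rightarrow>\<^sub>E B. j f = c \<and> j g = d}"
  proof (rule inj_onI, clarify)
    fix \<kappa> \<kappa>' assume k: "\<kappa> \<in> A \<rightarrow>\<^sub>E B" "\<kappa>' \<in> A \<rightarrow>\<^sub>E B"
      and eq: "restrict \<kappa> (A - {f, g}) = restrict \<kappa>' (A - {f, g})" "\<kappa>' f = \<kappa> f" "\<kappa>' g = \<kappa> g"
    have "\<kappa> y = \<kappa>' y" if "y \<in> A" for y
      using fun_cong[OF eq(1), of y] eq(2,3) that by (cases "y \<in> {f, g}") auto
    then show "\<kappa> = \<kappa>'" using k by (intro PiE_ext) auto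
  qed
  then have "card {j \<in> A \<rightarrow>\<^sub>E B. j f = c \<and> j g = d} \<le> card ?P"
    by (rule card_inj_on_le[OF _ _ finP], intro image_subsetI restrict_PiE_iff[THEN iffD2]) auto
  also have "\<dots> = card B ^ (card A - 2)" using assms by (simp add: card_PiE card_Diff_subset numeral_2_eq_2)
  finally show ?thesis .
qed

section \<open>Points on lines in the grid\<close>

definition affine :: "nat \<Rightarrow> (nat \<Rightarrow> nat) \<Rightarrow> (nat \<Rightarrow> nat) \<Rightarrow> nat \<Rightarrow> nat \<Rightarrow> nat" where
  "affine r z y \<alpha> = restrict (\<lambda>t. z t + \<alpha> * y t) {..<r}"

text \<open>The reason for the side \<open>h * D\<close>: labels below \<open>h\<close> never lead
  out of this larger box.\<close>

lemma affine_in_box: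
  assumes "z \<in> box r D" "y \<in> box r D" "\<alpha> < h"
  shows "affine r z y \<alpha> \<in> box r (h * D)"
proof -
  have "z t + \<alpha> * y t < h * D" if "t < r" for t
  proof -
    have "z t < D" "y t < D" using assms that by (auto simp: box_def)
    then have "z t + \<alpha> * y t < D + \<alpha> * D" by (meson add_less_le_mono less_imp_le mult_le_mono2)
    also have "\<dots> \<le> h * D" using assms(3) by (metis Suc_leI mult_Suc mult_le_mono1)
    finally show ?thesis .
  qed
  then show ?thesis by (auto simp: affine_def box_def)
qed

text \<open>Two points at distinct parameters determine the line together with its parametrisation;
  hence an edge will determine \<open>z\<close> and \<open>y\<close>.\<close>

lemma affine_inject:
  assumes "z \<in> box r D" "y \<in> box r D" "z' \<in> box r D" "y' \<in> box r D"
    and "affine r z y \<alpha> = affine r z' y' \<alpha>" "affine r z y \<beta> = affine r z' y' \<beta>" "\<alpha> \<noteq> \<beta>"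
  shows "z = z' \<and> y = y'"
proof -
  have *: "z t = z' t \<and> y t = y' t" if t: "t < r" for t
  proof -
    have e: "int (z t) + int \<alpha> * int (y t) = int (z' t) + int \<alpha> * int (y' t)"
      "int (z t) + int \<beta> * int (y t) = int (z' t) + int \<beta> * int (y' t)"
      using fun_cong[OF assms(5), of t] fun_cong[OF assms(6), of t] t
      by (simp_all add: affine_def flip: of_nat_mult of_nat_add)
    then have "(int \<alpha> - int \<beta>) * (int (y t) - int (y' t)) = 0" by (simp add: algebra_simps)
    then have "y t = y' t" using assms(7) by simp
    then show ?thesis using e by simp
  qed
  then show ?thesis using assms box_eqI by metis
qed

section \<open>The blow-up graph\<close>

locale removal_construction =
  fixes F C :: "'v::linorder ograph" and \<phi> :: "'v \<Rightarrow> 'v" and xs :: "'v list" and a :: "'v \<Rightarrow> nat"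
    and r D h n :: nat and X :: "(nat \<Rightarrow> nat) set" and e :: "nat \<Rightarrow> nat \<Rightarrow> nat"
  assumes F: "ordered_graph F" and core: "is_core C F" and \<phi>: "ordered_hom \<phi> F C"
    and cycle: "is_cycle C xs"
    and a_inj: "inj_on a (verts C)" and a_less: "\<And>v. v \<in> verts C \<Longrightarrow> a v < h"
    and a_cycle: "\<And>i. i < length xs \<Longrightarrow> a (xs ! i) = i"
    and X: "X \<subseteq> box r D" "convex_free r X"
    and e: "bij_betw e {..<(h * D) ^ r} (box r (h * D))"
    and D: "D > 0" and n: "card (verts F) * (h * D) ^ r \<le> n"
begin

abbreviation "s \<equiv> card (verts F)"
abbreviation "N \<equiv> (h * D) ^ r"

text \<open>The number of blocks of \<open>N\<close> consecutive vertices given to each part; a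
  block contains every grid point once. The assumption on \<open>n\<close> makes \<open>b\<close>
  positive.\<close>

definition "b = n div (s * N)"
definition "fs = sorted_list_of_set (verts F)"

text \<open>
  The vertex \<open>w\<close> lies in the part of \<open>ix w\<close>, where the parts are consecutive intervals, and sits at the
  point \<open>pos w\<close> of the grid. The \<open>min\<close> puts the surplus vertices into the last part.
\<close>

definition "ix w = fs ! min (w div N div b) (s - 1)"
definition "pos w = e (w mod N)"

text \<open>Two vertices over an edge of \<open>F\<close> are joined when some line with direction
  in \<open>X\<close> passes through both points at the labels of their parts. Labels are pulled
  back from the core along \<open>\<phi>\<close>.\<close>

definition "linked w w' \<longleftrightarrow> {ix w, ix w'} \<in> edges F \<and>
  (\<exists>z\<in>box r D. \<exists>y\<in>X. pos w = affine r z y (a (\<phi> (ix w))) \<and> pos w' = affine r z y (a (\<phi> (ix w'))))"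

definition G :: "nat ograph" where
  "G = \<lparr>verts = {..<n}, edges = {{w, w'} | w w'. w < n \<and> w' < n \<and> linked w w'}\<rparr>"

lemma finite_F [simp]: "finite (verts F)"
  using F by (simp add: ordered_graph_def)

lemma edge_F: "{x, y} \<in> edges F \<Longrightarrow> x \<in> verts F \<and> y \<in> verts F \<and> x \<noteq> y"
  using F by (auto simp: ordered_graph_def)

lemma C_subgraph: "subgraph C F"
  using core by (simp add: is_core_def)

lemma edge_C: "{x, y} \<in> edges C \<Longrightarrow> x \<in> verts C \<and> y \<in> verts C \<and> x \<noteq> y \<and> {x, y} \<in> edges F"
  using C_subgraph by (auto simp: subgraph_def ordered_graph_def)

lemma cycle_len: "3 \<le> length xs"
  using cycle by (simp add: is_cycle_def)

lemma cycle_edge: "Suc i < length xs \<Longrightarrow> {xs ! i, xs ! Suc i} \<in> edges C"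
  using cycle by (auto simp: is_cycle_def dest!: spec[of _ i])

lemma cycle_close: "{xs ! (length xs - 1), xs ! 0} \<in> edges C"
  using cycle cycle_len unfolding is_cycle_def
  by (metis Suc_pred' diff_less less_numeral_extra(1) mod_self order_less_le_trans zero_less_numeral)

lemma cycle_verts: "i < length xs \<Longrightarrow> xs ! i \<in> verts C"
  using cycle by (auto simp: is_cycle_def dest: edge_C)

lemma s_ge: "2 \<le> s"
proof -
  have "{xs ! 0, xs ! 1} \<in> edges F" "xs ! 0 \<noteq> xs ! 1"
    using edge_C[OF cycle_edge[of 0]] cycle_len by auto
  then have "card {xs ! 0, xs ! 1} \<le> s" by (intro card_mono) (auto dest: edge_F)
  with \<open>xs ! 0 \<noteq> xs ! 1\<close> show ?thesis by simp
qed

lemma h_pos: "h > 0"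
  using a_less[OF cycle_verts[of 0]] cycle_len by fastforce

lemma N_pos: "N > 0"
  using h_pos D by simp

lemma b_pos: "b > 0"
  using n N_pos s_ge unfolding b_def by (simp add: div_greater_zero_iff)

lemma length_fs [simp]: "length fs = s" and set_fs: "set fs = verts F" and sorted_fs: "sorted_wrt (<) fs"
  by (simp_all add: fs_def)

lemma ix_in: "ix w \<in> verts F"
  unfolding ix_def using s_ge by (subst set_fs[symmetric]) (intro nth_mem, auto)

lemma ix_mono: "w \<le> w' \<Longrightarrow> ix w \<le> ix w'"
proof -
  assume "w \<le> w'"
  then have "min (w div N div b) (s - 1) \<le> min (w' div N div b) (s - 1)"
    by (meson div_le_mono min.mono order_refl)
  then show ?thesis unfolding ix_def using s_ge sorted_fs
    by (intro sorted_nth_mono strict_sorted_imp_sorted) auto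
qed

lemma pos_in: "pos w \<in> box r (h * D)"
  unfolding pos_def using bij_betwE[OF e] N_pos by auto

lemma linked_sym: "linked w w' \<Longrightarrow> linked w' w"
  unfolding linked_def by (metis insert_commute)

lemma edge_G: "{w, w'} \<in> edges G \<longleftrightarrow> w < n \<and> w' < n \<and> linked w w'"
  unfolding G_def using linked_sym by (auto simp: doubleton_eq_iff)

lemma ordered_graph_G: "ordered_graph G"
proof -
  have "w \<noteq> w'" if "linked w w'" for w w'
    using that edge_F unfolding linked_def by blast
  then show ?thesis unfolding ordered_graph_def by (auto simp: G_def)
qed

lemma finite_edges_G: "finite (edges G)"
proof -
  have "edges G \<subseteq> Pow {..<n}" by (auto simp: G_def)
  then show ?thesis by (rule finite_subset) simp
qed

section \<open>Rarity of copies\<close>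

lemma hom_ix: "ordered_hom ix G F"
  unfolding ordered_hom_def edge_G linked_def by (simp add: ix_in monotone_on_def ix_mono)

text \<open>The images of the cycle form a closed walk in the grid to which
  \<open>cycle_rigid\<close> applies, so the third point is the reflection of the first in the
  second.\<close>

lemma copy_determined:
  assumes \<kappa>: "\<kappa> \<in> copies F G"
  shows "pos (\<kappa> (xs ! 2)) = restrict (\<lambda>t. 2 * pos (\<kappa> (xs ! 1)) t - pos (\<kappa> (xs ! 0)) t) {..<r}"
proof -
  have hom: "ordered_hom \<kappa> F G" using \<kappa> by (simp add: copies_def)
  \<comment> \<open>Following the copy by \<open>ix\<close> gives an endomorphism of
    \<open>F\<close>. The copy may put \<open>v\<close> into a part other than \<open>v\<close>, but
    by rigidity \<open>\<phi>\<close> sends that part back to \<open>v\<close>, so its label is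
    \<open>a v\<close>.\<close>
  have id: "\<phi> (ix (\<kappa> v)) = v" if "v \<in> verts C" for v
    using core_rigid[OF core \<phi> ordered_hom_comp[OF hom hom_ix] that] by simp
  have link: "\<exists>z\<in>box r D. \<exists>y\<in>X. pos (\<kappa> u) = affine r z y (a u) \<and> pos (\<kappa> v) = affine r z y (a v)"
    if "{u, v} \<in> edges C" for u v
  proof -
    have "{\<kappa> u, \<kappa> v} \<in> edges G"
      using edge_C[OF that] hom by (auto simp: ordered_hom_def)
    then show ?thesis
      using edge_C[OF that] unfolding edge_G linked_def by (simp add: id)
  qed
  \<comment> \<open>Labels grow by one along the cycle, so each step adds a vector of
    \<open>X\<close>; the closing edge joins the labels 0 and \<open>length xs - 1\<close>.\<close>
  have "pos (\<kappa> (xs ! 2)) t + pos (\<kappa> (xs ! 0)) t = 2 * pos (\<kappa> (xs ! 1)) t" if "t < r" for t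
  proof (rule cycle_rigid[OF X(2) cycle_len _ _ that, where p = "\<lambda>i. pos (\<kappa> (xs ! i))"])
    fix i assume i: "Suc i < length xs"
    show "\<exists>y\<in>X. \<forall>t<r. pos (\<kappa> (xs ! Suc i)) t = pos (\<kappa> (xs ! i)) t + y t"
      using link[OF cycle_edge[OF i]] i by (auto simp: a_cycle affine_def)
  next
    show "\<exists>y\<in>X. \<forall>t<r. pos (\<kappa> (xs ! (length xs - 1))) t = pos (\<kappa> (xs ! 0)) t + (length xs - 1) * y t"
    proof -
      have l: "length xs - 1 < length xs" "0 < length xs" using cycle_len by auto
      show ?thesis
        using link[OF cycle_close] a_cycle[OF l(1)] a_cycle[OF l(2)] by (fastforce simp: affine_def)
    qed
  qed
  \<comment> \<open>The preceding equation makes the truncated subtraction exact.\<close>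
  then have "pos (\<kappa> (xs ! 2)) t = 2 * pos (\<kappa> (xs ! 1)) t - pos (\<kappa> (xs ! 0)) t" if "t < r" for t
    using that by (metis add_diff_cancel_right')
  moreover have "pos (\<kappa> (xs ! 2)) \<in> extensional {..<r}"
    using pos_in by (auto simp: box_def PiE_def)
  ultimately show ?thesis by (intro ext) (auto simp: extensional_def)
qed

text \<open>All vertices but the third one of the cycle are chosen freely; that one then has a
  prescribed residue modulo \<open>N\<close>, because \<open>e\<close> is injective.\<close>

lemma card_copies: "card (copies F G) \<le> n ^ (s - 1) * (n div N + 1)"
proof -
  define q where "q g = restrict (\<lambda>t. 2 * pos (g (xs ! 1)) t - pos (g (xs ! 0)) t) {..<r}" for g :: "'v \<Rightarrow> nat"
  \<comment> \<open>If \<open>g\<close> does not come from a copy, \<open>q g\<close> may lie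
    outside the grid and \<open>inv_into\<close> is unspecified, but \<open>T g\<close> still lies
    in a single residue class.\<close>
  define T where "T g = {w. w < n \<and> w mod N = inv_into {..<N} e (q g)}" for g
  let ?V = "verts F" and ?x = "xs ! 2"
  have dist: "xs ! 0 \<noteq> xs ! 2" "xs ! 1 \<noteq> xs ! 2"
    using cycle cycle_len nth_eq_iff_index_eq[of xs 0 2] nth_eq_iff_index_eq[of xs 1 2]
    unfolding is_cycle_def by linarith+
  have in_F: "xs ! i \<in> verts F" if "i < 3" for i
    using cycle_verts[of i] C_subgraph that cycle_len by (auto simp: subgraph_def)
  have "copies F G \<subseteq> {\<kappa> \<in> ?V \<rightarrow>\<^sub>E {..<n}. \<kappa> ?x \<in> T (restrict \<kappa> (?V - {?x}))}"
  proof
    fix \<kappa> assume \<kappa>: "\<kappa> \<in> copies F G"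
    then have P: "\<kappa> \<in> ?V \<rightarrow>\<^sub>E {..<n}" by (auto simp: copies_def ordered_hom_def G_def PiE_def)
    have "q (restrict \<kappa> (?V - {?x})) = pos (\<kappa> ?x)"
      using copy_determined[OF \<kappa>] dist in_F[of 0] in_F[of 1] by (simp add: q_def)
    moreover have "inv_into {..<N} e (pos (\<kappa> ?x)) = \<kappa> ?x mod N"
      unfolding pos_def using e N_pos by (intro inv_into_f_f) (auto simp: bij_betw_imp_inj_on)
    ultimately show "\<kappa> \<in> {\<kappa> \<in> ?V \<rightarrow>\<^sub>E {..<n}. \<kappa> ?x \<in> T (restrict \<kappa> (?V - {?x}))}"
      using P in_F[of 2] by (auto simp: T_def)
  qed
  moreover have "finite {\<kappa> \<in> ?V \<rightarrow>\<^sub>E {..<n}. \<kappa> ?x \<in> T (restrict \<kappa> (?V - {?x}))}"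
    by (rule finite_subset[of _ "?V \<rightarrow>\<^sub>E {..<n}"]) (auto intro: finite_PiE)
  ultimately have "card (copies F G) \<le> card {\<kappa> \<in> ?V \<rightarrow>\<^sub>E {..<n}. \<kappa> ?x \<in> T (restrict \<kappa> (?V - {?x}))}"
    by (intro card_mono)
  also have "\<dots> \<le> card {..<n} ^ (s - 1) * (n div N + 1)"
    using in_F[of 2] by (intro card_PiE_determined) (use card_mod_class in \<open>auto simp: T_def\<close>)
  finally show ?thesis by simp
qed

section \<open>The planted copies\<close>

definition "rk f = inv_into {..<s} ((!) fs) f"
definition "place z y f = inv_into {..<N} e (affine r z y (a (\<phi> f)))"
text \<open>Puts \<open>f\<close> into block number \<open>j f\<close> of its part, at the grid
  point of \<open>f\<close> on the line of \<open>z\<close> and \<open>y\<close>. The free choice of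
  \<open>j\<close> yields \<open>b ^ s\<close> planted copies per line.\<close>

definition "emb z y j f = (rk f * b + j f) * N + place z y f"

lemma fs_bij: "bij_betw ((!) fs) {..<s} (verts F)"
proof (rule bij_betw_nth)
  show "distinct fs" by (simp add: fs_def)
qed (simp_all add: set_fs)

lemma rk_less: "f \<in> verts F \<Longrightarrow> rk f < s"
  using bij_betwE[OF bij_betw_inv_into[OF fs_bij]] by (auto simp: rk_def)

lemma fs_rk: "f \<in> verts F \<Longrightarrow> fs ! rk f = f"
  unfolding rk_def using fs_bij by (auto simp: bij_betw_def intro: f_inv_into_f)

lemma rk_strict_mono: "f \<in> verts F \<Longrightarrow> g \<in> verts F \<Longrightarrow> f < g \<Longrightarrow> rk f < rk g"
  using fs_rk rk_less strict_sorted_imp_sorted[OF sorted_fs]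
  by (metis length_fs linorder_not_less sorted_nth_mono)

context
  fixes z y j
  assumes z: "z \<in> box r D" and y: "y \<in> X" and j: "j \<in> verts F \<rightarrow>\<^sub>E {..<b}"
begin

lemma affine_in: "f \<in> verts F \<Longrightarrow> affine r z y (a (\<phi> f)) \<in> box r (h * D)"
  using z y X(1) \<phi> by (intro affine_in_box a_less) (auto simp: ordered_hom_def)

lemma place_less: "f \<in> verts F \<Longrightarrow> place z y f < N"
  using bij_betwE[OF bij_betw_inv_into[OF e]] affine_in by (auto simp: place_def)

lemma e_place: "f \<in> verts F \<Longrightarrow> e (place z y f) = affine r z y (a (\<phi> f))"
  using e affine_in unfolding place_def by (metis bij_betw_inv_into_right)

lemma j_less: "f \<in> verts F \<Longrightarrow> j f < b"
  using j by auto

lemma emb_mod: "f \<in> verts F \<Longrightarrow> emb z y j f mod N = place z y f"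
  using place_less by (simp add: emb_def)

lemma emb_div: "f \<in> verts F \<Longrightarrow> emb z y j f div N = rk f * b + j f"
  using place_less N_pos by (simp add: emb_def)

lemma emb_div_div: "f \<in> verts F \<Longrightarrow> emb z y j f div N div b = rk f"
  using j_less b_pos by (simp add: emb_div)

lemma emb_less: "f \<in> verts F \<Longrightarrow> emb z y j f < n"
proof -
  assume f: "f \<in> verts F"
  have "rk f * b + j f < rk f * b + b" using j_less[OF f] by simp
  also have "\<dots> \<le> s * b" using rk_less[OF f] by (metis Suc_leI add.commute mult_Suc mult_le_mono1)
  finally have "emb z y j f < s * b * N"
    unfolding emb_div[OF f, symmetric] using N_pos by (subst (asm) div_less_iff_less_mult)
  also have "\<dots> = b * (s * N)" by simp
  also have "\<dots> \<le> n" unfolding b_def by (rule div_times_less_eq_dividend)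
  finally show ?thesis .
qed

lemma ix_emb: "f \<in> verts F \<Longrightarrow> ix (emb z y j f) = f"
  using rk_less[of f] by (simp add: ix_def emb_div_div fs_rk min_absorb1)

lemma pos_emb: "f \<in> verts F \<Longrightarrow> pos (emb z y j f) = affine r z y (a (\<phi> f))"
  by (simp add: pos_def emb_mod e_place)

lemma emb_strict_mono: "f \<in> verts F \<Longrightarrow> g \<in> verts F \<Longrightarrow> f < g \<Longrightarrow> emb z y j f < emb z y j g"
  using rk_strict_mono emb_div_div by (metis div_le_mono linorder_not_less)

lemma emb_edge: "{f, g} \<in> edges F \<Longrightarrow> {emb z y j f, emb z y j g} \<in> edges G"
  using edge_F[of f g] z y by (auto simp: edge_G linked_def emb_less ix_emb pos_emb)

text \<open>Restricted to \<open>verts F\<close>, \<open>emb z y j\<close> is itself a copy of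
  \<open>F\<close> in \<open>G\<close>, so \<open>S\<close> must contain one of its edges.\<close>

lemma emb_hits:
  assumes "copies F (remove_edges G S) = {}"
  shows "\<exists>f g. {f, g} \<in> edges F \<and> {emb z y j f, emb z y j g} \<in> S"
proof (rule ccontr)
  assume none: "\<not> ?thesis"
  let ?\<kappa> = "restrict (emb z y j) (verts F)"
  have "?\<kappa> \<in> copies F (remove_edges G S)"
    unfolding copies_def ordered_hom_def
  proof (intro CollectI conjI allI impI)
    show "?\<kappa> \<in> verts F \<rightarrow> verts (remove_edges G S)"
      by (auto simp: remove_edges_def G_def emb_less)
    show "{?\<kappa> f, ?\<kappa> g} \<in> edges (remove_edges G S)" if "{f, g} \<in> edges F" for f g
      using that none edge_F[OF that] emb_edge[OF that] by (auto simp: remove_edges_def)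
    show "mono_on (verts F) ?\<kappa>"
      using emb_strict_mono by (auto simp: monotone_on_def order_le_less)
    show "inj_on ?\<kappa> (verts F)"
    proof (rule inj_onI)
      fix f g assume "f \<in> verts F" "g \<in> verts F" "?\<kappa> f = ?\<kappa> g"
      then show "f = g"
        using emb_strict_mono[of f g] emb_strict_mono[of g f] by (cases f g rule: linorder_cases) auto
    qed
  qed simp
  with assms show False by simp
qed

end

section \<open>The number of edges to remove\<close>

lemma emb_eq:
  assumes "z \<in> box r D" "y \<in> X" "j \<in> verts F \<rightarrow>\<^sub>E {..<b}"
    "z' \<in> box r D" "y' \<in> X" "j' \<in> verts F \<rightarrow>\<^sub>E {..<b}"
    and f: "f \<in> verts F" "f' \<in> verts F" and eq: "emb z y j f = emb z' y' j' f'"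
  shows "f = f'" "j f = j' f" "affine r z y (a (\<phi> f)) = affine r z' y' (a (\<phi> f))"
proof -
  note A = assms(1-3) and B = assms(4-6)
  show ff: "f = f'" using ix_emb[OF A f(1)] ix_emb[OF B f(2)] eq by simp
  show "j f = j' f" using emb_div[OF A f(1)] emb_div[OF B f(2)] eq ff by simp
  show "affine r z y (a (\<phi> f)) = affine r z' y' (a (\<phi> f))"
    using pos_emb[OF A f(1)] pos_emb[OF B f(2)] eq ff by simp
qed

text \<open>An edge determines the line, by its two grid points, and \<open>j\<close> at both ends;
  only the blocks of the other \<open>s - 2\<close> vertices remain free.\<close>

lemma card_fibre:
  "card {(z, y, j) \<in> box r D \<times> X \<times> (verts F \<rightarrow>\<^sub>E {..<b}).
     \<exists>f g. {f, g} \<in> edges F \<and> {emb z y j f, emb z y j g} = E} \<le> b ^ (s - 2)"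
  (is "card ?A \<le> _")
proof (cases "?A = {}")
  case True
  then show ?thesis by (metis card.empty le0)
next
  case False
  then obtain z0 y0 j0 f0 g0 where
    A: "z0 \<in> box r D" "y0 \<in> X" "j0 \<in> verts F \<rightarrow>\<^sub>E {..<b}"
    and fg0: "{f0, g0} \<in> edges F" and E: "E = {emb z0 y0 j0 f0, emb z0 y0 j0 g0}"
    by auto
  \<comment> \<open>\<open>\<phi>\<close> maps an edge of \<open>F\<close> to an edge of
    \<open>C\<close>, whose ends are distinct and thus have distinct labels.\<close>
  have ne: "a (\<phi> f0) \<noteq> a (\<phi> g0)"
    using fg0 \<phi> edge_C[of "\<phi> f0" "\<phi> g0"] a_inj by (auto simp: ordered_hom_def inj_on_def)
  let ?J = "{j \<in> verts F \<rightarrow>\<^sub>E {..<b}. j f0 = j0 f0 \<and> j g0 = j0 g0}"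
  have "?A \<subseteq> {z0} \<times> {y0} \<times> ?J"
  proof
    fix p assume "p \<in> ?A"
    then obtain z y j f g where p: "p = (z, y, j)"
      and B: "z \<in> box r D" "y \<in> X" "j \<in> verts F \<rightarrow>\<^sub>E {..<b}"
      and fg: "{f, g} \<in> edges F" and eq: "{emb z y j f, emb z y j g} = E"
      by blast
    \<comment> \<open>\<open>E\<close> is unordered; \<open>f'\<close> and \<open>g'\<close> are
      \<open>f\<close> and \<open>g\<close>, swapped if necessary to match \<open>f0\<close> and
      \<open>g0\<close>.\<close>
    obtain f' g' where fg': "f' \<in> verts F" "g' \<in> verts F"
      and eq': "emb z y j f' = emb z0 y0 j0 f0" "emb z y j g' = emb z0 y0 j0 g0"
      using eq edge_F[OF fg] unfolding E doubleton_eq_iff by metis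
    note * = emb_eq[OF B A fg'(1) _ eq'(1)] emb_eq[OF B A fg'(2) _ eq'(2)]
    have af: "f' = f0" "g' = g0" using * edge_F[OF fg0] by blast+
    have af2: "j f0 = j0 f0" "j g0 = j0 g0"
      "affine r z y (a (\<phi> f0)) = affine r z0 y0 (a (\<phi> f0))"
      "affine r z y (a (\<phi> g0)) = affine r z0 y0 (a (\<phi> g0))"
      using * edge_F[OF fg0] af by blast+
    have "z = z0 \<and> y = y0"
      using affine_inject[OF B(1) _ A(1) _ af2(3,4) ne] A(2) B(2) X(1) by blast
    then show "p \<in> {z0} \<times> {y0} \<times> ?J" using p af2 B(3) by auto
  qed
  moreover have "finite ({z0} \<times> {y0} \<times> ?J)"
  proof -
    have "finite ?J" by (rule finite_subset[of _ "verts F \<rightarrow>\<^sub>E {..<b}"]) (auto intro: finite_PiE)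
    then show ?thesis by simp
  qed
  ultimately have "card ?A \<le> card ({z0} \<times> {y0} \<times> ?J)" by (rule card_mono[rotated])
  also have "\<dots> = card ?J" by (simp add: card_cartesian_product)
  also have "\<dots> \<le> card {..<b} ^ (s - 2)"
    using edge_F[OF fg0] by (intro card_PiE_two_fixed) auto
  finally show ?thesis by simp
qed

text \<open>Double counting: each of the \<open>D ^ r * card X * b ^ s\<close> parameter triples has
  an edge in \<open>S\<close>, and each edge serves at most \<open>b ^ (s - 2)\<close>
  triples.\<close>

lemma card_removed:
  assumes S: "S \<subseteq> edges G" and none: "copies F (remove_edges G S) = {}"
  shows "D ^ r * card X * b\<^sup>2 \<le> card S"
proof -
  let ?I = "box r D \<times> X \<times> (verts F \<rightarrow>\<^sub>E {..<b})"
  define A where "A E = {(z, y, j) \<in> ?I. \<exists>f g. {f, g} \<in> edges F \<and> {emb z y j f, emb z y j g} = E}" for E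
  have finS: "finite S" using S finite_edges_G by (rule finite_subset)
  have finX: "finite X" using X(1) by (rule finite_subset) simp
  have finI: "finite ?I" using finX by (intro finite_SigmaI finite_PiE) auto
  have finA: "finite (A E)" for E
    by (rule finite_subset[OF _ finI]) (auto simp: A_def)
  have "?I \<subseteq> (\<Union>E\<in>S. A E)"
  proof
    fix p assume "p \<in> ?I"
    then obtain z y j where p: "p = (z, y, j)"
      and zyj: "z \<in> box r D" "y \<in> X" "j \<in> verts F \<rightarrow>\<^sub>E {..<b}"
      by auto
    obtain f g where "{f, g} \<in> edges F" "{emb z y j f, emb z y j g} \<in> S"
      using emb_hits[OF zyj none] by auto
    then show "p \<in> (\<Union>E\<in>S. A E)"
      unfolding A_def p using zyj by auto
  qed
  then have "card ?I \<le> card (\<Union>E\<in>S. A E)" using finS finA by (intro card_mono) auto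
  also have "\<dots> \<le> (\<Sum>E\<in>S. card (A E))" by (rule card_UN_le[OF finS])
  also have "\<dots> \<le> (\<Sum>E\<in>S. b ^ (s - 2))"
    unfolding A_def by (intro sum_mono card_fibre)
  finally have "D ^ r * card X * b ^ s \<le> card S * b ^ (s - 2)"
    by (simp add: card_cartesian_product card_PiE mult.assoc)
  moreover have "b ^ s = b\<^sup>2 * b ^ (s - 2)" using s_ge by (metis le_add_diff_inverse power_add)
  ultimately have "(D ^ r * card X * b\<^sup>2) * b ^ (s - 2) \<le> card S * b ^ (s - 2)"
    by (simp only: mult.assoc)
  then show ?thesis using b_pos by (simp only: mult_le_cancel2) simp
qed

end


section \<open>Bounds for \<open>D = h ^ r\<close>\<close>

context removal_construction
begin

context
  assumes D_eq: "D = h ^ r" and h3: "3 \<le> h" and r: "0 < r"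
begin

text \<open>Here \<open>N\<close> is \<open>h ^ (r * r) * h ^ r\<close>, and the spare factor
  \<open>h ^ r\<close>, at least 2, pays for the rounding in \<open>n div N + 1\<close>.\<close>

lemma card_copies_bound: "h ^ (r * r) * card (copies F G) \<le> n ^ s"
proof -
  have N: "N = h ^ (r * r) * h ^ r"
    by (simp add: D_eq power_mult_distrib power_mult)
  have "2 \<le> h ^ r"
    using h3 r self_le_power[of h r] by linarith
  then have "2 * (h ^ (r * r) * card (copies F G)) \<le> N * card (copies F G)"
    unfolding N by (metis mult.assoc mult.commute mult_le_mono1)
  also have "\<dots> \<le> N * (n ^ (s - 1) * (n div N + 1))"
    by (intro mult_le_mono2 card_copies)
  also have "\<dots> = n ^ (s - 1) * (N * (n div N) + N)"
    by (simp add: algebra_simps)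
  also have "\<dots> \<le> n ^ (s - 1) * (2 * n)"
  proof (rule mult_le_mono2)
    have "N \<le> s * N" using s_ge by simp
    then have "N \<le> n" using n by linarith
    moreover have "N * (n div N) \<le> n" by (rule times_div_less_eq_dividend)
    ultimately show "N * (n div N) + N \<le> 2 * n" by linarith
  qed
  also have "\<dots> = 2 * n ^ s"
  proof -
    have "n ^ (s - 1) * n = n ^ s" using s_ge by (intro power_minus_mult) auto
    then show ?thesis by (metis mult.left_commute)
  qed
  finally show ?thesis by simp
qed

text \<open>The exponent \<open>5 * r\<close> collects \<open>2 * r\<close> from the enlargement of
  the box by \<open>h\<close> in \<open>N\<^sup>2\<close>, \<open>r\<close> from
  \<open>r \<le> h ^ r\<close>, and \<open>2 * r\<close> from the \<open>D\<^sup>2\<close> in the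
  size bound for \<open>X\<close>.\<close>

lemma card_removed_bound:
  assumes large: "D ^ r \<le> r * D\<^sup>2 * card X"
    and S: "S \<subseteq> edges G" "copies F (remove_edges G S) = {}"
  shows "n\<^sup>2 \<le> 4 * s\<^sup>2 * h ^ (5 * r) * card S"
proof -
  let ?M = "s * N"
  have M: "?M > 0" using N_pos s_ge by simp
  have "n = b * ?M + n mod ?M" unfolding b_def by (simp only: div_mult_mod_eq)
  moreover have "n mod ?M < ?M" using M by (rule mod_less_divisor)
  moreover have "?M \<le> b * ?M" using b_pos by simp
  \<comment> \<open>As \<open>b\<close> is positive, rounding \<open>n\<close> down to a multiple of
    \<open>s * N\<close> loses less than half.\<close>
  ultimately have "n \<le> 2 * (b * ?M)" by linarith
  then have "n\<^sup>2 \<le> (2 * (b * ?M))\<^sup>2" by (rule power_mono) simp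
  also have "\<dots> = 4 * s\<^sup>2 * (N\<^sup>2 * b\<^sup>2)" by (simp add: power_mult_distrib)
  also have "\<dots> \<le> 4 * s\<^sup>2 * (h ^ (5 * r) * card S)"
  proof (rule mult_le_mono2)
    have "N\<^sup>2 = (h ^ r)\<^sup>2 * D ^ r * D ^ r"
      by (simp add: power_mult_distrib power2_eq_square)
    also have "\<dots> \<le> (h ^ r)\<^sup>2 * D ^ r * (r * D\<^sup>2 * card X)"
      using large by (rule mult_le_mono2)
    also have "\<dots> \<le> (h ^ r)\<^sup>2 * D ^ r * (h ^ r * D\<^sup>2 * card X)"
    proof (intro mult_le_mono2 mult_le_mono1)
      have "r < 2 ^ r" by (rule less_exp)
      also have "\<dots> \<le> h ^ r" using h3 by (intro power_mono) auto
      finally show "r \<le> h ^ r" by simp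
    qed
    also have "\<dots> = h ^ (5 * r) * (D ^ r * card X)"
    proof -
      have "h ^ (5 * r) = (h ^ r) ^ 5" by (simp add: power_mult[symmetric] mult.commute)
      then show ?thesis unfolding D_eq by (simp add: eval_nat_numeral algebra_simps)
    qed
    finally have "N\<^sup>2 * b\<^sup>2 \<le> h ^ (5 * r) * (D ^ r * card X) * b\<^sup>2" by (rule mult_le_mono1)
    also have "\<dots> \<le> h ^ (5 * r) * card S"
      using card_removed[OF S] by (simp add: mult.assoc)
    finally show "N\<^sup>2 * b\<^sup>2 \<le> h ^ (5 * r) * card S" .
  qed
  finally show ?thesis by (simp add: mult.assoc)
qed

end

end

section \<open>Choice of the parameters\<close>

theorem theorem1p2:
  fixes F C :: "'v::linorder ograph"
  assumes "ordered_graph F"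
    and "is_core C F"
    and "\<not> forest C"
  shows "\<exists>c::real. c > 0 \<and>
    (\<exists>\<epsilon>0::real. \<epsilon>0 > 0 \<and>
      (\<forall>\<epsilon>::real. 0 < \<epsilon> \<and> \<epsilon> < \<epsilon>0 \<longrightarrow>
        (\<exists>n0::nat. \<forall>n\<ge>n0. \<exists>G :: nat ograph.
          ordered_graph G \<and> card (verts G) = n \<and>
          real (card (copies F G)) \<le> \<epsilon> powr (c * ln (1 / \<epsilon>)) * real n ^ card (verts F) \<and>
          (\<forall>S \<subseteq> edges G. copies F (remove_edges G S) = {} \<longrightarrow>
             real (card S) \<ge> \<epsilon> * (real n)\<^sup>2))))"
proof -
  obtain xs where cycle: "is_cycle C xs" using assms(3) by (auto simp: forest_def)
  obtain \<phi> where \<phi>: "ordered_hom \<phi> F C" and CF: "subgraph C F"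
    using assms(2) by (auto simp: is_core_def)
  have C: "finite (verts C)" "edges C \<subseteq> {e. e \<subseteq> verts C \<and> card e = 2}" "verts C \<subseteq> verts F"
    using CF by (auto simp: subgraph_def ordered_graph_def)
  have xs: "3 \<le> length xs" "distinct xs" using cycle by (auto simp: is_cycle_def)
  have xsC: "set xs \<subseteq> verts C"
    using cycle C(2) by (fastforce simp: is_cycle_def in_set_conv_nth)
  define h where "h = card (verts C)"
  define s where "s = card (verts F)"
  have "length xs \<le> h"
    unfolding h_def using xsC C(1) xs(2) by (metis card_mono distinct_card)
  then have h3: "3 \<le> h" using xs by simp
  have "h \<le> s" unfolding h_def s_def using C(3) assms(1) by (intro card_mono) (auto simp: ordered_graph_def)
  then have s3: "3 \<le> s" using h3 by simp
  obtain a where a: "inj_on a (verts C)" "\<And>v. v \<in> verts C \<Longrightarrow> a v < h"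
    "\<And>i. i < length xs \<Longrightarrow> a (xs ! i) = i"
    using cycle_labelling[OF C(1) xs(2) xsC] unfolding h_def by metis
  define l where "l = ln (real h)"
  have l: "l > 0" using h3 by (simp add: l_def)
  have exp_l: "real (h ^ k) = exp (real k * l)" for k
    using h3 by (simp add: l_def exp_of_nat_mult)
  \<comment> \<open>The 400 is the square of the 20 in \<open>r_low\<close>: it turns
    \<open>L < 20 * (real r * l)\<close> into
    \<open>c * L * L \<le> real (r * r) * l\<close>.\<close>
  define c where "c = 1 / (400 * l)"
  \<comment> \<open>The first entry ensures \<open>r \<ge> 1\<close>; the second lets half of
    \<open>L\<close> absorb the constant \<open>4 * s\<^sup>2\<close>.\<close>
  define M where "M = max (10 * l) (2 * ln (4 * (real s)\<^sup>2))"
  have c: "c > 0" using l by (simp add: c_def)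
  show ?thesis
  proof (rule exI[of _ c], rule conjI[OF c], rule exI[of _ "exp (- M)"], intro conjI allI impI)
    show "exp (- M) > 0" by simp
    fix \<epsilon> :: real assume \<epsilon>: "0 < \<epsilon> \<and> \<epsilon> < exp (- M)"
    define L where "L = ln (1 / \<epsilon>)"
    have eps: "\<epsilon> = exp (- L)" using \<epsilon> by (simp add: L_def ln_div)
    then have "M < L" using \<epsilon> by simp
    then have L1: "10 * l < L" and L2: "2 * ln (4 * (real s)\<^sup>2) < L" by (simp_all add: M_def)
    \<comment> \<open>The largest \<open>r\<close> for which \<open>h ^ (5 * r)\<close> is at most
      \<open>exp (L / 2)\<close>, the other half of the budget.\<close>
    define r where "r = nat \<lfloor>L / (10 * l)\<rfloor>"
    have q1: "1 < L / (10 * l)" using L1 l by simp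
    then have f1: "1 \<le> \<lfloor>L / (10 * l)\<rfloor>" by (simp add: le_floor_iff)
    then have r0: "0 < r" by (simp add: r_def)
    have r_real: "real r = of_int \<lfloor>L / (10 * l)\<rfloor>" using f1 by (simp add: r_def)
    have "real r \<le> L / (10 * l)" unfolding r_real by simp
    then have r_up: "10 * (real r * l) \<le> L" using l by (simp add: field_simps)
    have "L / (10 * l) < real r + 1" unfolding r_real by linarith
    then have "L / (10 * l) < 2 * real r" using r0 by linarith
    then have r_low: "L < 20 * (real r * l)" using l by (simp add: field_simps)
    have sparse: "exp (- (real (r * r) * l)) \<le> \<epsilon> powr (c * L)"
    proof -
      have "L * L \<le> (20 * (real r * l)) * (20 * (real r * l))"
        using r_low L1 l by (intro mult_mono) auto
      then have "c * L * L \<le> real (r * r) * l"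
        using l by (simp add: c_def field_simps)
      then show ?thesis by (simp add: eps powr_def)
    qed
    have dense: "\<epsilon> * (4 * (real s)\<^sup>2 * real (h ^ (5 * r))) \<le> 1"
    proof -
      have "4 * (real s)\<^sup>2 = exp (ln (4 * (real s)\<^sup>2))" using s3 by simp
      then have "\<epsilon> * (4 * (real s)\<^sup>2 * real (h ^ (5 * r))) = exp (- L + (ln (4 * (real s)\<^sup>2) + real (5 * r) * l))"
        unfolding exp_l eps by (simp only: exp_add)
      also have "\<dots> \<le> 1" using L2 r_up by simp
      finally show ?thesis .
    qed
    obtain X where X: "X \<subseteq> box r (h ^ r)" "convex_free r X" and large: "(h ^ r) ^ r \<le> r * (h ^ r)\<^sup>2 * card X"
      using large_convex_free_set[of r "h ^ r"] r0 h3 by auto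
    obtain e where e: "bij_betw e {..<(h * h ^ r) ^ r} (box r (h * h ^ r))"
      using ex_bij_betw_nat_finite[OF finite_box[of r "h * h ^ r"]] by (auto simp: atLeast0LessThan)
    show "\<exists>n0. \<forall>n\<ge>n0. \<exists>G :: nat ograph.
          ordered_graph G \<and> card (verts G) = n \<and>
          real (card (copies F G)) \<le> \<epsilon> powr (c * ln (1 / \<epsilon>)) * real n ^ card (verts F) \<and>
          (\<forall>S \<subseteq> edges G. copies F (remove_edges G S) = {} \<longrightarrow>
             real (card S) \<ge> \<epsilon> * (real n)\<^sup>2)"
    \<comment> \<open>From this size on, every part contains at least one complete block.\<close>
    proof (intro exI[of _ "s * (h * h ^ r) ^ r"] allI impI)
      fix n assume n: "s * (h * h ^ r) ^ r \<le> n"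
      interpret removal_construction F C \<phi> xs a r "h ^ r" h n X e
        by unfold_locales (use assms(1,2) \<phi> cycle a X e n h3 in \<open>auto simp: s_def\<close>)
      have "real (card (copies F G)) \<le> \<epsilon> powr (c * ln (1 / \<epsilon>)) * real n ^ card (verts F)"
      proof -
        have "real (h ^ (r * r)) * real (card (copies F G)) \<le> real n ^ card (verts F)"
          using card_copies_bound[OF refl h3 r0] by (metis of_nat_le_iff of_nat_mult of_nat_power)
        then have "real (card (copies F G)) \<le> exp (- (real (r * r) * l)) * real n ^ card (verts F)"
          unfolding exp_l by (simp add: exp_minus field_simps)
        also have "\<dots> \<le> \<epsilon> powr (c * L) * real n ^ card (verts F)"
          using sparse by (intro mult_right_mono) auto
        finally show ?thesis by (simp add: L_def)
      qed
      moreover have "\<epsilon> * (real n)\<^sup>2 \<le> real (card S)"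
        if S: "S \<subseteq> edges G" "copies F (remove_edges G S) = {}" for S
      proof -
        have "real (n\<^sup>2) \<le> real (4 * s\<^sup>2 * h ^ (5 * r) * card S)"
          using card_removed_bound[OF refl h3 r0 large S] unfolding s_def of_nat_le_iff .
        then have "(real n)\<^sup>2 \<le> 4 * (real s)\<^sup>2 * real (h ^ (5 * r)) * real (card S)" by simp
        then have "\<epsilon> * (real n)\<^sup>2 \<le> \<epsilon> * (4 * (real s)\<^sup>2 * real (h ^ (5 * r)) * real (card S))"
          using \<epsilon> by (intro mult_left_mono) auto
        also have "\<dots> = (\<epsilon> * (4 * (real s)\<^sup>2 * real (h ^ (5 * r)))) * real (card S)"
          by (simp only: mult.assoc)
        also have "\<dots> \<le> 1 * real (card S)" using dense by (intro mult_right_mono) auto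
        finally show ?thesis by simp
      qed
      moreover have "card (verts G) = n" by (simp add: G_def)
      ultimately show "\<exists>G :: nat ograph.
          ordered_graph G \<and> card (verts G) = n \<and>
          real (card (copies F G)) \<le> \<epsilon> powr (c * ln (1 / \<epsilon>)) * real n ^ card (verts F) \<and>
          (\<forall>S \<subseteq> edges G. copies F (remove_edges G S) = {} \<longrightarrow>
             real (card S) \<ge> \<epsilon> * (real n)\<^sup>2)"
        using ordered_graph_G by blast
    qed
  qed
qed

end
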